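(* Let $\mathbb{F}$ be a field with $\operatorname{char}\mathbb{F}\neq 2$. Let $A=\mathbb{F}a\oplus\mathbb{F}b$ be the two-dimensional commutative (not necessarily associative) $\mathbb{F}$-algebra with basis $a,b$ and multiplication $$a^2=a,\qquad ab=2b,\qquad b^2=b.$$ Let $\star$ be the fusion law on the set $\{0,1,2\}\subseteq\mathbb{F}$ given by $$0\star 0=\{0,1\},\quad 1\star 1=\{1\},\quad 1\star 2=2\star 1=\{2\},\quad 2\star 2=\{2\},\quad 0\star 1=1\star 0=0\star 2=2\star 0=\varnothing,$$ and let $X=\{a,b\}$. Then the pair $(A,X)$ is a primitive axial algebra for this fusion law. Moreover, $$R(A,X)=0\qquad\text{and}\qquad J(A)=\mathbb{F}b.$$ Consequently, $R(A,X)\subsetneq J(A)$, and the primitive axis $b$ belongs to $J(A)$.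
   Context: Algebras are commutative and not necessarily associative. For an element $x$ of an $\mathbb{F}$-algebra $A$, $L_x:A\to A$, $L_x(y)=xy$, is left multiplication by $x$, and for $\lambda\in\mathbb{F}$, $A_\lambda(x)=\{y\in A: xy=\lambda y\}$ is its $\lambda$-eigenspace (zero if $\lambda$ is not an eigenvalue of $L_x$). A fusion law is a finite set $\mathcal{S}\subseteq\mathbb{F}$ together with a symmetric map $\star$ assigning to each pair $\lambda,\mu\in\mathcal{S}$ a subset $\lambda\star\mu\subseteq\mathcal{S}$. An axis for the fusion law is a nonzero idempotent $x\in A$ such that $L_x$ is diagonalizable with all eigenvalues in $\mathcal{S}$, i.e. $A=\bigoplus_{\lambda\in\mathcal{S}}A_\lambda(x)$, and for all $\lambda,\mu\in\mathcal{S}$, $$A_\lambda(x)A_\mu(x)\subseteq\bigoplus_{\nu\in\lambda\star\mu}A_\nu(x),$$ where the sum over the empty set is $0$. An axis $x$ is primitive if $A_1(x)=\mathbb{F}x$. A primitive axial algebra is a pair $(A,X)$ where $A$ is a commutative algebra and $X\subseteq A$ is a set of primitive axes (for the given fusion law) generating $A$ as an algebra. For a primitive axial algebra $(A,X)$, the axial radical $R(A,X)$ is the unique largest ideal of $A$ containing no element of $X$. The Jacobson radical $J(A)$ is the intersection of all maximal (proper) ideals of $A$, with $J(A)=A$ if there are no maximal ideals. *)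

theory Defs
  imports Complex_Main "HOL-Library.Product_Plus"
begin

section \<open>Commutative, not necessarily associative, algebras over a field\<close>

locale comm_nonassoc_algebra = vector_space scale
  for scale :: "'f::field \<Rightarrow> 'v::ab_group_add \<Rightarrow> 'v" (infixr \<open>*s\<close> 75) +
  fixes mult :: "'v \<Rightarrow> 'v \<Rightarrow> 'v" (infixl \<open>\<odot>\<close> 70)
  assumes mult_commute: "x \<odot> y = y \<odot> x"
    and mult_add_left: "(x + y) \<odot> z = x \<odot> z + y \<odot> z"
    and mult_scale_left: "(c *s x) \<odot> y = c *s (x \<odot> y)"
begin

text \<open>By commutativity, one-sided absorption suffices.\<close>

definition ideal :: "'v set \<Rightarrow> bool" where
  "ideal I \<longleftrightarrow> subspace I \<and> (\<forall>x y. y \<in> I \<longrightarrow> x \<odot> y \<in> I)"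

definition maximal_ideal :: "'v set \<Rightarrow> bool" where
  "maximal_ideal M \<longleftrightarrow>
     ideal M \<and> M \<noteq> UNIV \<and> (\<forall>I. ideal I \<and> M \<subseteq> I \<longrightarrow> I = M \<or> I = UNIV)"

text \<open>If there are no maximal ideals, the intersection is \<^term>\<open>UNIV\<close>, i.e. the whole algebra.\<close>

definition jacobson_radical :: "'v set" where
  "jacobson_radical = \<Inter>{M. maximal_ideal M}"

definition subalgebra :: "'v set \<Rightarrow> bool" where
  "subalgebra B \<longleftrightarrow> subspace B \<and> (\<forall>x\<in>B. \<forall>y\<in>B. x \<odot> y \<in> B)"

definition eigenspace :: "'v \<Rightarrow> 'f \<Rightarrow> 'v set" where
  "eigenspace x l = {y. x \<odot> y = l *s y}"

text \<open>The sum of a finite family of subspaces; it is \<open>{0}\<close> for the empty family.\<close>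

definition subspace_sum :: "'i set \<Rightarrow> ('i \<Rightarrow> 'v set) \<Rightarrow> 'v set" where
  "subspace_sum I V = {\<Sum>i\<in>I. f i | f. \<forall>i\<in>I. f i \<in> V i}"

definition is_direct_sum :: "'v set \<Rightarrow> 'i set \<Rightarrow> ('i \<Rightarrow> 'v set) \<Rightarrow> bool" where
  "is_direct_sum W I V \<longleftrightarrow>
     W = subspace_sum I V \<and>
     (\<forall>f. (\<forall>i\<in>I. f i \<in> V i) \<and> (\<Sum>i\<in>I. f i) = 0 \<longrightarrow> (\<forall>i\<in>I. f i = 0))"

text \<open>
  In the fusion condition a plain sum is written: it is a partial sum of the direct sum
  in the preceding conjunct, hence itself direct.
\<close>

definition axis :: "'f set \<Rightarrow> ('f \<Rightarrow> 'f \<Rightarrow> 'f set) \<Rightarrow> 'v \<Rightarrow> bool" where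
  "axis S star x \<longleftrightarrow>
     x \<noteq> 0 \<and> x \<odot> x = x \<and>
     is_direct_sum UNIV S (eigenspace x) \<and>
     (\<forall>l\<in>S. \<forall>m\<in>S. \<forall>y\<in>eigenspace x l. \<forall>z\<in>eigenspace x m.
        y \<odot> z \<in> subspace_sum (star l m) (eigenspace x))"

definition primitive_axis :: "'f set \<Rightarrow> ('f \<Rightarrow> 'f \<Rightarrow> 'f set) \<Rightarrow> 'v \<Rightarrow> bool" where
  "primitive_axis S star x \<longleftrightarrow> axis S star x \<and> eigenspace x 1 = span {x}"

text \<open>\<open>GREATEST\<close> is taken with respect to inclusion.\<close>

definition axial_radical :: "'v set \<Rightarrow> 'v set" where
  "axial_radical X = (GREATEST I. ideal I \<and> I \<inter> X = {})"

end


section \<open>Fusion laws and primitive axial algebras\<close>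

text \<open>The values of \<open>star\<close> outside \<open>S \<times> S\<close> are irrelevant.\<close>

locale fusion_law =
  fixes S :: "'f::field set" and star :: "'f \<Rightarrow> 'f \<Rightarrow> 'f set"
  assumes finite_S: "finite S"
    and star_commute: "l \<in> S \<Longrightarrow> m \<in> S \<Longrightarrow> star l m = star m l"
    and star_subset: "l \<in> S \<Longrightarrow> m \<in> S \<Longrightarrow> star l m \<subseteq> S"

locale primitive_axial_algebra =
  comm_nonassoc_algebra scale mult + fusion_law S star
  for scale :: "'f::field \<Rightarrow> 'v::ab_group_add \<Rightarrow> 'v" (infixr \<open>*s\<close> 75)
    and mult :: "'v \<Rightarrow> 'v \<Rightarrow> 'v" (infixl \<open>\<odot>\<close> 70)
    and S :: "'f set" and star :: "'f \<Rightarrow> 'f \<Rightarrow> 'f set" +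
  fixes X :: "'v set"
  assumes primitive_axes: "x \<in> X \<Longrightarrow> primitive_axis S star x"
    and generating: "subalgebra hull X = UNIV"


section \<open>The example\<close>

text \<open>The case distinction is as intended when \<open>0\<close>, \<open>1\<close>, \<open>2\<close> are distinct, i.e. in characteristic not two.\<close>

definition star012 :: "'f::field \<Rightarrow> 'f \<Rightarrow> 'f set" where
  "star012 l m =
     (if (l, m) = (0, 0) then {0, 1}
      else if (l, m) = (1, 1) then {1}
      else if (l, m) \<in> {(1, 2), (2, 1), (2, 2)} then {2}
      else {})"

definition example_algebra ::
    "('f::field \<Rightarrow> 'v::ab_group_add \<Rightarrow> 'v) \<Rightarrow> ('v \<Rightarrow> 'v \<Rightarrow> 'v) \<Rightarrow> 'v \<Rightarrow> 'v \<Rightarrow> bool" where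
  "example_algebra scale mult a b \<longleftrightarrow>
     comm_nonassoc_algebra scale mult \<and>
     a \<noteq> b \<and> \<not> module.dependent scale {a, b} \<and> module.span scale {a, b} = UNIV \<and>
     mult a a = a \<and> mult a b = scale 2 b \<and> mult b b = b"

text \<open>The algebra exists over every field, with underlying space \<open>'f \<times> 'f\<close>.\<close>

lemma example_algebra_exists:
  "example_algebra (\<lambda>c (x, y). (c * x, c * y))
     (\<lambda>(x, y) (x', y'). (x * x', 2 * (x * y') + 2 * (y * x') + y * y'))
     (1, 0) (0, 1 :: 'f::field)"
proof -
  let ?s = "\<lambda>(c::'f) (x, y). (c * x, c * y)"
  let ?m = "\<lambda>(x::'f, y) (x', y'). (x * x', 2 * (x * y') + 2 * (y * x') + y * y')"
  interpret comm_nonassoc_algebra ?s ?m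
    by unfold_locales (auto simp: algebra_simps)
  have "(x, y) \<in> span {(1, 0), (0, 1)}" for x y :: 'f
  proof -
    have "?s x (1, 0) + ?s y (0, 1) \<in> span {(1, 0), (0, 1)}"
      by (intro span_add span_scale span_base) auto
    then show ?thesis by simp
  qed
  then have "span {(1::'f, 0::'f), (0, 1)} = UNIV" by auto
  moreover have "independent {(1::'f, 0::'f), (0, 1)}"
    by (auto simp: independent_insert span_singleton zero_prod_def)
  ultimately show ?thesis
    unfolding example_algebra_def using comm_nonassoc_algebra_axioms by auto
qed

end

theory Submission
  imports Defs
begin

text \<open>
  In coordinates, \<open>L\<^sub>a\<close> is diagonal with eigenvectors \<open>a\<close> (for \<open>1\<close>) and \<open>b\<close> (for \<open>2\<close>), and
  \<open>L\<^sub>b\<close> is diagonal with eigenvectors \<open>b\<close> (for \<open>1\<close>) and \<open>a - 2b\<close> (for \<open>0\<close>); the only fusion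
  rule that is not immediate is \<open>(a - 2b)\<^sup>2 = (a - 2b) - 2b\<close>.
  If an ideal contains \<open>w = x a + y b\<close>, it contains \<open>a w - w = y b\<close>, hence also \<open>x a\<close>. So an
  ideal not contained in the line spanned by \<open>b\<close> contains \<open>a\<close>, thus \<open>ab = 2b\<close> and everything.
  The ideals are therefore \<open>0\<close>, this line and the whole algebra.
\<close>

section \<open>Distinctness of the scalars 0, 1, 2 and the fusion law\<close>

lemma two_neq_zero_if_CHAR:
  assumes "CHAR('f::field) \<noteq> 2"
  shows "(2::'f) \<noteq> 0"
proof
  assume "(2::'f) = 0"
  then have "CHAR('f) dvd 2"
    using of_nat_eq_0_iff_char_dvd[where 'a = 'f, of 2] by simp
  then have "CHAR('f) \<le> 2" "CHAR('f) \<noteq> 0"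
    by (auto dest: dvd_imp_le intro!: Nat.gr0I)
  \<comment> \<open>The characteristic is now 1 or 2; the first never occurs in a field and the
    second is excluded.\<close>
  with assms CHAR_not_1'[where 'a = 'f] show False by linarith
qed

lemma two_neq_one: "(2::'f::field) \<noteq> 1"
  by (metis add_cancel_right_right one_add_one zero_neq_one)

lemma fusion_law_star012: "fusion_law {0, 1, 2::'f::field} star012"
proof
  show "star012 l m = star012 m l" for l m :: 'f
    unfolding star012_def by (simp add: conj_commute disj_ac)
  show "star012 l m \<subseteq> {0, 1, 2}" for l m :: 'f
    unfolding star012_def by simp
qed simp

section \<open>Bilinearity, sums of eigenspaces and principal ideals in a general algebra\<close>

context comm_nonassoc_algebra
begin

lemma mult_add_right: "z \<odot> (x + y) = z \<odot> x + z \<odot> y"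
  by (metis mult_commute mult_add_left)

lemma mult_scale_right: "x \<odot> (c *s y) = c *s (x \<odot> y)"
  by (metis mult_commute mult_scale_left)

lemma zero_mult: "0 \<odot> v = 0" and mult_zero: "v \<odot> 0 = 0"
  using mult_scale_left[of 0 0 v] mult_scale_right[of v 0 0] by auto

lemma subspace_scale_cancel:
  assumes "subspace I" "c *s v \<in> I" "c \<noteq> 0"
  shows "v \<in> I"
  using subspace_scale[OF assms(1,2), of "inverse c"] assms(3) by simp

lemma subspace_sum_empty: "subspace_sum {} V = {0}"
  by (auto simp: subspace_sum_def)

text \<open>The zero family is admissible for every index set. This settles all fusion rules with a
  vanishing product.\<close>

lemma zero_in_subspace_sum: "0 \<in> subspace_sum I (eigenspace x)"
  unfolding subspace_sum_def mem_Collect_eq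
  by (rule exI[of _ "\<lambda>_. 0"]) (simp add: eigenspace_def mult_zero)

text \<open>Splits off one summand; together with \<open>subspace_sum_empty\<close> it evaluates
  sums over explicit index sets such as those of \<open>star012\<close>.\<close>

lemma subspace_sum_insert:
  assumes "finite I" "i \<notin> I"
  shows "subspace_sum (insert i I) V = {u + v | u v. u \<in> V i \<and> v \<in> subspace_sum I V}"
proof (intro equalityI subsetI)
  fix w assume "w \<in> subspace_sum (insert i I) V"
  with assms show "w \<in> {u + v | u v. u \<in> V i \<and> v \<in> subspace_sum I V}"
    by (fastforce simp: subspace_sum_def)
next
  fix w assume "w \<in> {u + v | u v. u \<in> V i \<and> v \<in> subspace_sum I V}"
  then obtain u f where w: "w = u + sum f I" and u: "u \<in> V i" and f: "\<forall>j\<in>I. f j \<in> V j"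
    by (auto simp: subspace_sum_def)
  \<comment> \<open>Since \<open>i\<close> is not in \<open>I\<close>, the new component does not
    disturb the old ones.\<close>
  have "sum (f(i := u)) I = sum f I"
    using assms by (intro sum.cong) auto
  with assms w have "w = sum (f(i := u)) (insert i I)" by simp
  moreover have "\<forall>j\<in>insert i I. (f(i := u)) j \<in> V j" using u f by auto
  ultimately show "w \<in> subspace_sum (insert i I) V"
    unfolding subspace_sum_def by blast
qed

text \<open>By linearity, absorption has to be checked on the generator only.\<close>

lemma ideal_span_singleton:
  assumes "\<And>x. x \<odot> v \<in> span {v}"
  shows "ideal (span {v})"
proof -
  have "x \<odot> (k *s v) \<in> span {v}" for x k
    using span_scale[OF assms] by (simp add: mult_scale_right)
  then have "x \<odot> y \<in> span {v}" if "y \<in> span {v}" for x y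
    using that by (metis span_singleton imageE)
  then show ?thesis by (auto simp: ideal_def)
qed

lemma ideal_zero: "ideal {0}"
  using ideal_span_singleton[of 0] mult_scale_right[of _ 0 0] by (simp add: span_singleton)

end

section \<open>The two-dimensional algebra in coordinates\<close>

locale two_dim_example = comm_nonassoc_algebra scale mult
  for scale :: "'f::field \<Rightarrow> 'v::ab_group_add \<Rightarrow> 'v" (infixr \<open>*s\<close> 75)
    and mult :: "'v \<Rightarrow> 'v \<Rightarrow> 'v" (infixl \<open>\<odot>\<close> 70) +
  fixes a b :: 'v
  assumes char_neq_2: "CHAR('f) \<noteq> 2"
    and a_neq_b: "a \<noteq> b"
    and independent_ab: "independent {a, b}"
    and span_ab: "span {a, b} = UNIV"
    and aa: "a \<odot> a = a"
    and ab: "a \<odot> b = 2 *s b"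
    and bb: "b \<odot> b = b"
begin

lemma two_neq_zero: "(2::'f) \<noteq> 0"
  by (rule two_neq_zero_if_CHAR[OF char_neq_2])

lemma ba: "b \<odot> a = 2 *s b"
  using ab mult_commute by metis

lemma coordinates:
  obtains x y where "v = x *s a + y *s b"
proof -
  have "v \<in> span {a, b}" by (simp add: span_ab)
  then obtain x y where "v - x *s a = y *s b"
    by (auto simp: span_insert span_singleton)
  then have "v = x *s a + y *s b" by (simp add: algebra_simps)
  with that show ?thesis .
qed

lemma lin_comb_eq_zero_iff: "x *s a + y *s b = 0 \<longleftrightarrow> x = 0 \<and> y = 0"
proof
  assume eq: "x *s a + y *s b = 0"
  have a: "a \<notin> span {b}" and b: "b \<noteq> 0"
    using independent_ab a_neq_b by (auto simp: independent_insert)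
  have "x *s a = (- y) *s b" using eq by (simp add: eq_neg_iff_add_eq_0)
  then have "x *s a \<in> span {b}" unfolding span_singleton by blast
  with a have "x = 0" using subspace_scale_cancel subspace_span by blast
  with eq b show "x = 0 \<and> y = 0" by simp
qed simp

text \<open>Linear independence applied to the difference; it turns each vector equation into two
  scalar ones.\<close>

lemma lin_comb_eq_iff:
  "x *s a + y *s b = x' *s a + y' *s b \<longleftrightarrow> x = x' \<and> y = y'"
proof -
  have "x *s a + y *s b - (x' *s a + y' *s b) = (x - x') *s a + (y - y') *s b"
    by (simp add: algebra_simps)
  then show ?thesis
    using lin_comb_eq_zero_iff[of "x - x'" "y - y'"] by auto
qed

lemma mult_lin_comb:
  "(x *s a + y *s b) \<odot> (x' *s a + y' *s b)
    = (x * x') *s a + (2 * x * y' + 2 * y * x' + y * y') *s b"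
  by (simp add: mult_add_left mult_add_right mult_scale_left mult_scale_right aa ab ba bb
      algebra_simps)

lemma a_mult_lin_comb: "a \<odot> (x *s a + y *s b) = x *s a + (2 * y) *s b"
  using mult_lin_comb[of 1 0 x y] by simp

text \<open>The term \<open>0 *s a\<close> is kept so that \<open>lin_comb_eq_iff\<close> applies to
  the right-hand side.\<close>

lemma b_mult_lin_comb: "b \<odot> (x *s a + y *s b) = 0 *s a + (2 * x + y) *s b"
  using mult_lin_comb[of 0 1 x y] by simp

lemma scale_lin_comb: "c *s (x *s a + y *s b) = (c * x) *s a + (c * y) *s b"
  by (simp add: algebra_simps)

lemma in_span_b_iff: "x *s a + y *s b \<in> span {b} \<longleftrightarrow> x = 0"
proof -
  have "x *s a + y *s b \<in> span {b} \<longleftrightarrow> (\<exists>k. x *s a + y *s b = 0 *s a + k *s b)"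
    by (auto simp: span_singleton)
  then show ?thesis unfolding lin_comb_eq_iff by simp
qed

section \<open>Eigenspaces of the two generators\<close>

lemma eigenspaces_a:
  "eigenspace a 0 = {0}" "eigenspace a 1 = range (\<lambda>x. x *s a)"
  "eigenspace a 2 = range (\<lambda>y. y *s b)"
proof -
  have *: "x *s a + y *s b \<in> eigenspace a l \<longleftrightarrow> x = l * x \<and> 2 * y = l * y" for x y l
    unfolding eigenspace_def mem_Collect_eq a_mult_lin_comb scale_lin_comb lin_comb_eq_iff ..
  show "eigenspace a 0 = {0}"
  proof (intro set_eqI)
    fix v show "v \<in> eigenspace a 0 \<longleftrightarrow> v \<in> {0}"
      by (rule coordinates[of v]) (simp add: * lin_comb_eq_zero_iff two_neq_zero)
  qed
  show "eigenspace a 1 = range (\<lambda>x. x *s a)"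
  proof (intro equalityI subsetI)
    fix v assume v: "v \<in> eigenspace a 1"
    obtain x y where xy: "v = x *s a + y *s b" by (rule coordinates)
    from v have "2 * y = 1 * y" by (simp add: xy *)
    then have "y = 0" using two_neq_one mult_right_cancel by blast
    then show "v \<in> range (\<lambda>x. x *s a)" by (auto simp: xy)
  next
    fix v assume "v \<in> range (\<lambda>x. x *s a)"
    then show "v \<in> eigenspace a 1" using *[of _ 0 1] by auto
  qed
  show "eigenspace a 2 = range (\<lambda>y. y *s b)"
  proof (intro equalityI subsetI)
    fix v assume v: "v \<in> eigenspace a 2"
    obtain x y where xy: "v = x *s a + y *s b" by (rule coordinates)
    from v have "1 * x = 2 * x" by (simp add: xy *)
    then have "x = 0" using two_neq_one[where 'f = 'f] by (metis mult_right_cancel)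
    then show "v \<in> range (\<lambda>y. y *s b)" by (auto simp: xy)
  next
    fix v assume "v \<in> range (\<lambda>y. y *s b)"
    then show "v \<in> eigenspace a 2" using *[of 0 _ 2] by auto
  qed
qed

text \<open>The eigenvector equation reads \<open>0 = l * x\<close> and
  \<open>2 * x + y = l * y\<close>. For \<open>l = 2\<close> the first part forces
  \<open>x = 0\<close>, and then \<open>y = 2 * y\<close> forces \<open>y = 0\<close>.\<close>

lemma eigenspaces_b:
  "eigenspace b 0 = range (\<lambda>x. x *s a + (- 2 * x) *s b)"
  "eigenspace b 1 = range (\<lambda>y. y *s b)" "eigenspace b 2 = {0}"
proof -
  have *: "x *s a + y *s b \<in> eigenspace b l \<longleftrightarrow> 0 = l * x \<and> 2 * x + y = l * y" for x y l
    unfolding eigenspace_def mem_Collect_eq b_mult_lin_comb scale_lin_comb lin_comb_eq_iff ..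
  show "eigenspace b 0 = range (\<lambda>x. x *s a + (- 2 * x) *s b)"
  proof (intro equalityI subsetI)
    fix v assume v: "v \<in> eigenspace b 0"
    obtain x y where xy: "v = x *s a + y *s b" by (rule coordinates)
    from v have "2 * x + y = 0" by (simp add: xy *)
    then have "y = - 2 * x" by (simp add: eq_neg_iff_add_eq_0 add.commute)
    then show "v \<in> range (\<lambda>x. x *s a + (- 2 * x) *s b)" by (auto simp: xy)
  next
    fix v assume "v \<in> range (\<lambda>x. x *s a + (- 2 * x) *s b)"
    then show "v \<in> eigenspace b 0" by (auto simp only: *) auto
  qed
  show "eigenspace b 1 = range (\<lambda>y. y *s b)"
  proof (intro equalityI subsetI)
    fix v assume v: "v \<in> eigenspace b 1"
    obtain x y where xy: "v = x *s a + y *s b" by (rule coordinates)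
    with v show "v \<in> range (\<lambda>y. y *s b)" by (auto simp: *)
  next
    fix v assume "v \<in> range (\<lambda>y. y *s b)"
    then show "v \<in> eigenspace b 1" using *[of 0 _ 1] by auto
  qed
  show "eigenspace b 2 = {0}"
  proof (intro set_eqI)
    fix v
    obtain x y where xy: "v = x *s a + y *s b" by (rule coordinates)
    have "y = 2 * y \<longleftrightarrow> y = 0"
      by (metis add_cancel_right_right mult_2 mult_zero_right)
    then show "v \<in> eigenspace b 2 \<longleftrightarrow> v \<in> {0}"
      using two_neq_zero by (auto simp: xy * lin_comb_eq_zero_iff)
  qed
qed

section \<open>Direct decompositions, fusion rules and generation\<close>

lemma sum_012: "(\<Sum>i\<in>{0, 1, 2::'f}. f i) = f 0 + f 1 + (f 2 :: 'v)"
  using two_neq_zero two_neq_one[where 'f = 'f] by (simp add: add.assoc)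

text \<open>Replaces families indexed by eigenvalues by explicit triples; this is possible because
  the three indices are distinct.\<close>

lemma is_direct_sum_012:
  fixes V :: "'f \<Rightarrow> 'v set"
  assumes "\<And>v. \<exists>p\<in>V 0. \<exists>q\<in>V 1. \<exists>r\<in>V 2. v = p + q + r"
    and "\<And>p q r. p \<in> V 0 \<Longrightarrow> q \<in> V 1 \<Longrightarrow> r \<in> V 2 \<Longrightarrow> p + q + r = 0 \<Longrightarrow> p = 0 \<and> q = 0 \<and> r = 0"
  shows "is_direct_sum UNIV {0, 1, 2} V"
proof -
  have "v \<in> subspace_sum {0, 1, 2} V" for v
  proof -
    obtain p q r where "p \<in> V 0" "q \<in> V 1" "r \<in> V 2" "v = p + q + r" using assms(1) by blast
    then show ?thesis
      using two_neq_zero two_neq_one[where 'f = 'f]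
      by (auto simp: subspace_sum_insert subspace_sum_empty add.assoc)
  qed
  then have "UNIV = subspace_sum {0, 1, 2} V" by blast
  moreover have "\<forall>i\<in>{0, 1, 2}. f i = 0"
    if "\<forall>i\<in>{0, 1, 2}. f i \<in> V i" "(\<Sum>i\<in>{0, 1, 2}. f i) = 0" for f
    using assms(2)[of "f 0" "f 1" "f 2"] that unfolding sum_012 by simp
  ultimately show ?thesis unfolding is_direct_sum_def by blast
qed

lemma star012_simps:
  "star012 0 0 = {0, 1::'f}" "star012 1 1 = {1::'f}" "star012 1 2 = {2::'f}"
  "star012 2 1 = {2::'f}" "star012 2 2 = {2::'f}" "star012 0 1 = ({}::'f set)"
  "star012 1 0 = ({}::'f set)" "star012 0 2 = ({}::'f set)" "star012 2 0 = ({}::'f set)"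
  using two_neq_zero two_neq_one[where 'f = 'f] by (auto simp: star012_def)

lemma a_neq_zero: "a \<noteq> 0" and b_neq_zero: "b \<noteq> 0"
  using lin_comb_eq_zero_iff[of 1 0] lin_comb_eq_zero_iff[of 0 1] by auto

text \<open>The nonzero eigenspaces are the lines of \<open>a\<close> and \<open>b\<close>, so the
  fusion rules are read off the multiplication table; those involving 0 hold because that eigenspace
  is zero.\<close>

lemma primitive_axis_a: "primitive_axis {0, 1, 2} star012 a"
proof -
  have in_range: "c *s v \<in> range (\<lambda>x. x *s v)" "0 \<in> range (\<lambda>x. x *s v)" for c v
    by (auto intro: image_eqI[where x = 0])
  have "is_direct_sum UNIV {0, 1, 2} (eigenspace a)"
  proof (rule is_direct_sum_012)
    fix v
    obtain x y where "v = x *s a + y *s b" by (rule coordinates)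
    then show "\<exists>p\<in>eigenspace a 0. \<exists>q\<in>eigenspace a 1. \<exists>r\<in>eigenspace a 2. v = p + q + r"
      by (auto simp: eigenspaces_a)
  qed (auto simp: eigenspaces_a lin_comb_eq_zero_iff)
  moreover have "y \<odot> z \<in> subspace_sum (star012 l m) (eigenspace a)"
    if "l \<in> {0, 1, 2}" "m \<in> {0, 1, 2}" "y \<in> eigenspace a l" "z \<in> eigenspace a m" for l m y z
    using that
    by (auto simp: star012_simps eigenspaces_a subspace_sum_insert subspace_sum_empty
        mult_scale_left mult_scale_right aa ab ba bb zero_mult mult_zero in_range)
  ultimately show ?thesis
    unfolding primitive_axis_def axis_def
    using a_neq_zero aa by (simp add: span_singleton eigenspaces_a)
qed

text \<open>Here the eigenspace for 2 vanishes, so only products among the eigenvalues 0 and 1 need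
  computation.\<close>

lemma primitive_axis_b: "primitive_axis {0, 1, 2} star012 b"
proof -
  have "is_direct_sum UNIV {0, 1, 2} (eigenspace b)"
  proof (rule is_direct_sum_012)
    fix v
    obtain x y where v: "v = x *s a + y *s b" by (rule coordinates)
    \<comment> \<open>The 0-component is determined by the coordinate \<open>x\<close>; the second
      term compensates its share \<open>- 2 * x\<close> of the \<open>b\<close>-coordinate.\<close>
    have "v = (x *s a + (- 2 * x) *s b) + (y + 2 * x) *s b + 0"
      unfolding v by (simp add: algebra_simps)
    then show "\<exists>p\<in>eigenspace b 0. \<exists>q\<in>eigenspace b 1. \<exists>r\<in>eigenspace b 2. v = p + q + r"
      unfolding eigenspaces_b by blast
  next
    fix p q r
    assume "p \<in> eigenspace b 0" "q \<in> eigenspace b 1" "r \<in> eigenspace b 2" and 0: "p + q + r = 0"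
    then obtain x y where p: "p = x *s a + (- 2 * x) *s b" and q: "q = y *s b" and r: "r = 0"
      unfolding eigenspaces_b by blast
    have "p + q + r = x *s a + (- 2 * x + y) *s b"
      unfolding p q r by (simp add: algebra_simps)
    then have "x = 0" "- 2 * x + y = 0"
      using 0 lin_comb_eq_zero_iff[of x "- 2 * x + y"] by metis+
    then show "p = 0 \<and> q = 0 \<and> r = 0" by (auto simp: p q r)
  qed
  moreover have "y \<odot> z \<in> subspace_sum (star012 l m) (eigenspace b)"
    if lm: "l \<in> {0, 1, 2}" "m \<in> {0, 1, 2}" and y: "y \<in> eigenspace b l" and z: "z \<in> eigenspace b m"
    for l m y z
  proof -
    have b_eig: "b \<odot> (x *s a + (- 2 * x) *s b) = 0" "(x *s a + (- 2 * x) *s b) \<odot> b = 0" for x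
      using b_mult_lin_comb[of x "- 2 * x"] mult_commute[of b] by auto
    have fusion_00: "y \<odot> z \<in> subspace_sum {0, 1} (eigenspace b)"
      if y: "y \<in> eigenspace b 0" and z: "z \<in> eigenspace b 0"
    proof -
      obtain s t where y: "y = s *s a + (- 2 * s) *s b" and z: "z = t *s a + (- 2 * t) *s b"
        using y z unfolding eigenspaces_b by blast
      \<comment> \<open>The \<open>b\<close>-coordinate of the product is
        \<open>- 4 * (s * t)\<close>; half of it completes the 0-eigenvector and half remains in the
        1-eigenspace.\<close>
      have "y \<odot> z = ((s * t) *s a + (- 2 * (s * t)) *s b) + (- 2 * (s * t)) *s b"
        unfolding y z mult_lin_comb by (simp add: algebra_simps flip: scale_left_distrib)
      then have "y \<odot> z \<in> {u + v | u v. u \<in> eigenspace b 0 \<and> v \<in> eigenspace b 1}"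
        unfolding eigenspaces_b by blast
      then show ?thesis by (simp add: subspace_sum_insert subspace_sum_empty)
    qed
    have fusion_01: "y \<odot> z \<in> subspace_sum {} (eigenspace b)"
      if "y \<in> eigenspace b 0 \<and> z \<in> eigenspace b 1 \<or> y \<in> eigenspace b 1 \<and> z \<in> eigenspace b 0"
      using that unfolding eigenspaces_b subspace_sum_empty
      by (auto simp only: mult_scale_left mult_scale_right b_eig scale_zero_right insert_iff)
    have fusion_11: "y \<odot> z \<in> subspace_sum {1} (eigenspace b)"
      if "y \<in> eigenspace b 1" "z \<in> eigenspace b 1"
      using that
      by (auto simp: eigenspaces_b subspace_sum_insert subspace_sum_empty
          mult_scale_left mult_scale_right bb)
    consider "l = 2 \<or> m = 2" | "l = 0" "m = 0" | "l = 0" "m = 1" | "l = 1" "m = 0" | "l = 1" "m = 1"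
      using lm by blast
    then show ?thesis
    proof cases
      case 1
      then have "y = 0 \<or> z = 0" using y z eigenspaces_b(3) by blast
      then have "y \<odot> z = 0" using zero_mult mult_zero by metis
      then show ?thesis by (simp only: zero_in_subspace_sum)
    next
      case 2
      with y z fusion_00 show ?thesis by (simp only: star012_simps)
    next
      case 3
      with y z fusion_01 show ?thesis by (simp only: star012_simps simp_thms)
    next
      case 4
      with y z fusion_01 show ?thesis by (simp only: star012_simps simp_thms)
    next
      case 5
      with y z fusion_11 show ?thesis by (simp only: star012_simps)
    qed
  qed
  ultimately show ?thesis
    unfolding primitive_axis_def axis_def
    using b_neq_zero bb by (simp add: span_singleton eigenspaces_b)
qed

text \<open>A subalgebra is a subspace, hence contains the span of \<open>a\<close> and
  \<open>b\<close>.\<close>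

lemma generating_ab: "subalgebra hull {a, b} = UNIV"
proof -
  have "B = UNIV" if "subalgebra B" "{a, b} \<subseteq> B" for B
    using that span_minimal[of "{a, b}" B] span_ab unfolding subalgebra_def by auto
  then show ?thesis unfolding hull_def by blast
qed

section \<open>Classification of the ideals and the two radicals\<close>

lemma ideal_span_b: "ideal (span {b})"
proof (rule ideal_span_singleton)
  fix v
  show "v \<odot> b \<in> span {b}"
    by (rule coordinates[of v])
      (simp add: mult_add_left mult_scale_left ab bb span_add span_scale span_base)
qed

text \<open>Left multiplication by \<open>a\<close> has eigenvalues 1 and 2, so subtracting the
  identity yields the projection onto the line of \<open>b\<close> along \<open>a\<close>.\<close>

lemma ideal_lin_combD:
  assumes "ideal I" and w: "x *s a + y *s b \<in> I"
  shows "x *s a \<in> I" "y *s b \<in> I"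
proof -
  have I: "subspace I" and "a \<odot> (x *s a + y *s b) \<in> I"
    using assms by (auto simp: ideal_def)
  then have "a \<odot> (x *s a + y *s b) - (x *s a + y *s b) \<in> I"
    using w by (intro subspace_diff)
  moreover have "a \<odot> (x *s a + y *s b) - (x *s a + y *s b) = y *s b"
    unfolding a_mult_lin_comb by (simp add: algebra_simps flip: scale_left_distrib mult_2)
  ultimately show y: "y *s b \<in> I" by simp
  have "(x *s a + y *s b) - y *s b \<in> I" by (rule subspace_diff[OF I w y])
  then show "x *s a \<in> I" by simp
qed

text \<open>Dividing \<open>b \<odot> a = 2 *s b\<close> by 2 recovers \<open>b\<close>. In
  characteristic two the line of \<open>a\<close> would be a proper ideal.\<close>

lemma ideal_eq_UNIV_if_a:
  assumes "ideal I" "a \<in> I"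
  shows "I = UNIV"
proof -
  have I: "subspace I" and "b \<odot> a \<in> I" using assms by (auto simp: ideal_def)
  then have "b \<in> I" using subspace_scale_cancel two_neq_zero by (metis ba)
  with I assms(2) show ?thesis using span_minimal[of "{a, b}" I] span_ab by auto
qed

lemma proper_ideal_subset:
  assumes "ideal I" "I \<noteq> UNIV"
  shows "I \<subseteq> span {b}"
proof
  fix v assume v: "v \<in> I"
  obtain x y where xy: "v = x *s a + y *s b" by (rule coordinates)
  have "x *s a \<in> I" using ideal_lin_combD(1) assms(1) v xy by blast
  \<comment> \<open>Otherwise \<open>x\<close> is invertible, so \<open>a\<close> lies in
    \<open>I\<close> and \<open>I\<close> is everything.\<close>
  then have "x = 0"
    using ideal_eq_UNIV_if_a assms subspace_scale_cancel unfolding ideal_def by metis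
  then show "v \<in> span {b}" by (simp only: xy in_span_b_iff)
qed

lemma axial_radical_ab: "axial_radical {a, b} = {0}"
  unfolding axial_radical_def
proof (rule Greatest_equality)
  show "ideal {0} \<and> {0} \<inter> {a, b} = {}"
    using ideal_zero a_neq_zero b_neq_zero by auto
next
  fix I assume I: "ideal I \<and> I \<inter> {a, b} = {}"
  \<comment> \<open>Missing \<open>a\<close> makes \<open>I\<close> proper; missing \<open>b\<close>
    then excludes all nonzero multiples of \<open>b\<close>.\<close>
  then have "I \<subseteq> span {b}" by (intro proper_ideal_subset) auto
  moreover have "c *s b \<notin> I" if "c \<noteq> 0" for c
    using I that subspace_scale_cancel unfolding ideal_def by blast
  ultimately show "I \<subseteq> {0}" by (fastforce simp: span_singleton)
qed

lemma span_b_neq_UNIV: "span {b} \<noteq> UNIV"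
  using in_span_b_iff[of 1 0] by auto

text \<open>The line of \<open>b\<close> is itself a proper ideal and contains all the
  others.\<close>

lemma maximal_ideal_iff: "maximal_ideal M \<longleftrightarrow> M = span {b}"
proof
  assume "maximal_ideal M"
  then show "M = span {b}"
    using proper_ideal_subset ideal_span_b span_b_neq_UNIV
    unfolding maximal_ideal_def by metis
next
  assume "M = span {b}"
  then show "maximal_ideal M"
    using proper_ideal_subset ideal_span_b span_b_neq_UNIV
    unfolding maximal_ideal_def by blast
qed

lemma jacobson_radical_eq: "jacobson_radical = span {b}"
  unfolding jacobson_radical_def maximal_ideal_iff by simp

lemma primitive_axial_algebra_ab: "primitive_axial_algebra scale mult {0, 1, 2} star012 {a, b}"
proof -
  interpret fusion_law "{0, 1, 2::'f}" star012
    by (rule fusion_law_star012)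
  show ?thesis
    using primitive_axis_a primitive_axis_b generating_ab by unfold_locales auto
qed

end

theorem theorem2p1:
  fixes scale :: "'f::field \<Rightarrow> 'v::ab_group_add \<Rightarrow> 'v"
    and mult :: "'v \<Rightarrow> 'v \<Rightarrow> 'v"
    and a b :: 'v
  assumes "CHAR('f) \<noteq> 2"
    and "example_algebra scale mult a b"
  shows "primitive_axial_algebra scale mult {0, 1, 2} star012 {a, b}
    \<and> comm_nonassoc_algebra.axial_radical scale mult {a, b} = {0}
    \<and> comm_nonassoc_algebra.jacobson_radical scale mult = module.span scale {b}
    \<and> comm_nonassoc_algebra.axial_radical scale mult {a, b}
        \<subset> comm_nonassoc_algebra.jacobson_radical scale mult
    \<and> comm_nonassoc_algebra.primitive_axis scale mult {0, 1, 2} star012 b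
    \<and> b \<in> comm_nonassoc_algebra.jacobson_radical scale mult"
proof -
  interpret comm_nonassoc_algebra scale mult
    using assms(2) by (simp add: example_algebra_def)
  interpret two_dim_example scale mult a b
    by unfold_locales (use assms in \<open>unfold example_algebra_def, blast+\<close>)
  have b: "b \<in> jacobson_radical"
    by (simp add: jacobson_radical_eq span_base)
  \<comment> \<open>Strictness is witnessed by the nonzero element \<open>b\<close>.\<close>
  have "axial_radical {a, b} \<subset> jacobson_radical"
    unfolding axial_radical_ab using b b_neq_zero by (auto simp: jacobson_radical_eq span_zero)
  then show ?thesis
    by (intro conjI primitive_axial_algebra_ab axial_radical_ab jacobson_radical_eq
        primitive_axis_b b)
qed

end
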